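(* There exists an undirected weighted graph $\mathcal{G}=(V,E,w)$ such that the set function $S\mapsto C(S)$ defined on subsets of $E$ is not a submodular function of $S$.
   Context: $\mathcal{G}=(V,E,w)$ is a finite undirected graph with $|V|=n$ and positive edge weights $w:E\to\mathbb{R}_+$. Its Laplacian is $L=D-A$, where $A$ is the weighted adjacency matrix and $D$ the diagonal (weighted) degree matrix. The forest matrix is $\Omega=(I+L)^{-1}=(\omega_{ij})_{n\times n}$. The forest index is $\rho(\mathcal{G})=\sum_{i<j}(\omega_{ii}+\omega_{jj}-2\omega_{ij})=n\,\mathrm{Tr}(\Omega)-n$. For $S\subseteq E$, $\mathcal{G}-S$ is the weighted graph on the same node set $V$ obtained by deleting the edges in $S$ (weights of the remaining edges unchanged), and $C(S)=\rho(\mathcal{G}-S)-\rho(\mathcal{G})$. A set function $f:2^X\to\mathbb{R}$ on a finite set $X$ is submodular if $f(S\cup\{u\})-f(S)\ge f(T\cup\{u\})-f(T)$ for all $S\subseteq T\subseteq X$ and all $u\in X\setminus T$. *)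

theory Defs
  imports Complex_Main "Jordan_Normal_Form.Gauss_Jordan_Elimination"
    "Jordan_Normal_Form.Determinant"
begin

text \<open>
  A weighted graph is given by the number \<open>n\<close> of its nodes (the node set being \<open>{0..<n}\<close>, so that
  nodes index rows and columns of matrices), a set \<open>E\<close> of edges, each being an unordered pair of
  distinct nodes, and a weight function. Weights outside \<open>E\<close> are irrelevant.
\<close>

definition weighted_graph :: "nat \<Rightarrow> nat set set \<Rightarrow> (nat set \<Rightarrow> real) \<Rightarrow> bool" where
  "weighted_graph n E w \<longleftrightarrow>
     (\<forall>e\<in>E. \<exists>i<n. \<exists>j<n. i \<noteq> j \<and> e = {i, j}) \<and> (\<forall>e\<in>E. w e > 0)"

definition adjacency_mat :: "nat \<Rightarrow> nat set set \<Rightarrow> (nat set \<Rightarrow> real) \<Rightarrow> real mat" where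
  "adjacency_mat n E w = mat n n (\<lambda>(i, j). if {i, j} \<in> E then w {i, j} else 0)"

definition degree_mat :: "nat \<Rightarrow> nat set set \<Rightarrow> (nat set \<Rightarrow> real) \<Rightarrow> real mat" where
  "degree_mat n E w = mat n n (\<lambda>(i, j). if i = j then (\<Sum>e | e \<in> E \<and> i \<in> e. w e) else 0)"

definition laplacian :: "nat \<Rightarrow> nat set set \<Rightarrow> (nat set \<Rightarrow> real) \<Rightarrow> real mat" where
  "laplacian n E w = degree_mat n E w - adjacency_mat n E w"

text \<open>The inverse always exists; see \<open>forest_mat_inverse\<close> below.\<close>

definition forest_mat :: "nat \<Rightarrow> nat set set \<Rightarrow> (nat set \<Rightarrow> real) \<Rightarrow> real mat" where
  "forest_mat n E w = the (mat_inverse (1\<^sub>m n + laplacian n E w))"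

definition forest_index :: "nat \<Rightarrow> nat set set \<Rightarrow> (nat set \<Rightarrow> real) \<Rightarrow> real" where
  "forest_index n E w =
     (let \<Omega> = forest_mat n E w
      in \<Sum>j<n. \<Sum>i<j. \<Omega> $$ (i, i) + \<Omega> $$ (j, j) - 2 * \<Omega> $$ (i, j))"

definition deletion_gain ::
    "nat \<Rightarrow> nat set set \<Rightarrow> (nat set \<Rightarrow> real) \<Rightarrow> nat set set \<Rightarrow> real" where
  "deletion_gain n E w S = forest_index n (E - S) w - forest_index n E w"

definition submodular_on :: "'a set \<Rightarrow> ('a set \<Rightarrow> real) \<Rightarrow> bool" where
  "submodular_on X f \<longleftrightarrow>
     (\<forall>S T u. S \<subseteq> T \<and> T \<subseteq> X \<and> u \<in> X - T \<longrightarrow>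
        f (S \<union> {u}) - f S \<ge> f (T \<union> {u}) - f T)"

lemma weighted_graph_edgeE:
  assumes "weighted_graph n E w" "e \<in> E"
  obtains i j where "i < n" "j < n" "i \<noteq> j" "e = {i, j}"
proof -
  have "\<exists>i<n. \<exists>j<n. i \<noteq> j \<and> e = {i, j}"
    using assms by (simp add: weighted_graph_def)
  then show thesis by (elim exE conjE) (rule that)
qed

lemma weighted_graph_finite:
  assumes "weighted_graph n E w"
  shows "finite E"
proof (rule finite_subset)
  show "E \<subseteq> Pow {..<n}"
  proof
    fix e assume "e \<in> E"
    with assms obtain i j where "i < n" "j < n" "e = {i, j}"
      by (rule weighted_graph_edgeE)
    then show "e \<in> Pow {..<n}" by simp
  qed
qed simp

lemma degree_eq_sum_adjacency:
  assumes g: "weighted_graph n E w" and i: "i < n"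
  shows "(\<Sum>e | e \<in> E \<and> i \<in> e. w e) = (\<Sum>j<n. adjacency_mat n E w $$ (i, j))"
proof -
  have "(\<Sum>e | e \<in> E \<and> i \<in> e. w e) = (\<Sum>j | j < n \<and> {i, j} \<in> E. w {i, j})"
  proof (rule sum.reindex_cong[where l = "\<lambda>j. {i, j}"])
    show "inj_on (\<lambda>j. {i, j}) {j. j < n \<and> {i, j} \<in> E}"
      by (auto simp: inj_on_def doubleton_eq_iff)
    show "{e. e \<in> E \<and> i \<in> e} = (\<lambda>j. {i, j}) ` {j. j < n \<and> {i, j} \<in> E}"
    proof (intro equalityI subsetI)
      fix e assume "e \<in> {e. e \<in> E \<and> i \<in> e}"
      then have e: "e \<in> E" "i \<in> e" by auto
      obtain a b where ab: "a < n" "b < n" "e = {a, b}"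
        using g e(1) by (rule weighted_graph_edgeE)
      then consider "e = {i, b}" | "e = {i, a}" using e(2) by (auto simp: insert_commute)
      then show "e \<in> (\<lambda>j. {i, j}) ` {j. j < n \<and> {i, j} \<in> E}"
        using ab(1,2) e(1) by cases blast+
    qed auto
  qed simp
  also have "\<dots> = (\<Sum>j<n. if {i, j} \<in> E then w {i, j} else 0)"
    by (rule sum.mono_neutral_cong_left) auto
  finally show ?thesis using i by (simp add: adjacency_mat_def)
qed

lemma det_forest_nonzero:
  assumes g: "weighted_graph n E w"
  shows "det (1\<^sub>m n + laplacian n E w) \<noteq> 0"
proof
  let ?M = "1\<^sub>m n + laplacian n E w"
  define a where "a i j = adjacency_mat n E w $$ (i, j)" for i j
  have M: "?M \<in> carrier_mat n n"
    unfolding laplacian_def degree_mat_def adjacency_mat_def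
    by (intro add_carrier_mat minus_carrier_mat mat_carrier)
  assume "det ?M = 0"
  then obtain v where v: "v \<in> carrier_vec n" "v \<noteq> 0\<^sub>v n" "?M *\<^sub>v v = 0\<^sub>v n"
    using det_0_iff_vec_prod_zero[OF M] by blast
  have n0: "n \<noteq> 0" using v by (intro notI) auto
  have a_nonneg: "a i j \<ge> 0" if "i < n" "j < n" for i j
    using g that by (auto simp: a_def adjacency_mat_def weighted_graph_def less_imp_le)
  have eq: "(1 + (\<Sum>j<n. a i j)) * v $ i = (\<Sum>j<n. a i j * v $ j)" if i: "i < n" for i
  proof -
    have entry: "?M $$ (i, j) = (if j = i then 1 + (\<Sum>j<n. a i j) else 0) - a i j" if "j < n" for j
      using i that degree_eq_sum_adjacency[OF g i]
      by (auto simp: laplacian_def degree_mat_def a_def) (auto simp: adjacency_mat_def)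
    have "0 = (?M *\<^sub>v v) $ i" using v i by simp
    also have "\<dots> = (\<Sum>j<n. ?M $$ (i, j) * v $ j)"
    proof -
      have "(K *\<^sub>v v) $ i = (\<Sum>j<n. K $$ (i, j) * v $ j)" if "K \<in> carrier_mat n n" for K
        using that v(1) i by (simp add: scalar_prod_def lessThan_atLeast0)
      from this[OF M] show ?thesis .
    qed
    also have "\<dots> = (\<Sum>j<n. (if j = i then (1 + (\<Sum>j<n. a i j)) * v $ j else 0) - a i j * v $ j)"
      by (rule sum.cong) (auto simp: entry algebra_simps)
    also have "\<dots> = (1 + (\<Sum>j<n. a i j)) * v $ i - (\<Sum>j<n. a i j * v $ j)"
      using i by (simp add: sum_subtractf)
    finally show ?thesis by simp
  qed
  obtain i where i: "i < n" and imax: "\<And>j. j < n \<Longrightarrow> \<bar>v $ j\<bar> \<le> \<bar>v $ i\<bar>"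
  proof -
    let ?A = "(\<lambda>j. \<bar>v $ j\<bar>) ` {..<n}"
    have "Max ?A \<in> ?A" using n0 by (intro Max_in) auto
    then obtain i where "i < n" "Max ?A = \<bar>v $ i\<bar>" by auto
    moreover have "\<bar>v $ j\<bar> \<le> Max ?A" if "j < n" for j using that by (intro Max_ge) auto
    ultimately show thesis using that by metis
  qed
  have "(1 + (\<Sum>j<n. a i j)) * \<bar>v $ i\<bar> = \<bar>(1 + (\<Sum>j<n. a i j)) * v $ i\<bar>"
  proof -
    have "0 \<le> (\<Sum>j<n. a i j)" using a_nonneg i by (intro sum_nonneg) auto
    then show ?thesis by (simp add: abs_mult)
  qed
  also have "\<dots> \<le> (\<Sum>j<n. \<bar>a i j * v $ j\<bar>)"
    using eq[OF i] by simp
  also have "\<dots> \<le> (\<Sum>j<n. a i j * \<bar>v $ i\<bar>)"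
    by (rule sum_mono) (use a_nonneg i imax in \<open>auto simp: abs_mult intro!: mult_left_mono\<close>)
  finally have "\<bar>v $ i\<bar> \<le> 0" by (simp add: sum_distrib_right distrib_right)
  then have "v $ j = 0" if "j < n" for j using imax[OF that] by simp
  then have "v = 0\<^sub>v n" using v by (intro eq_vecI) auto
  with v show False by simp
qed

lemma forest_mat_inverse:
  assumes "weighted_graph n E w"
  shows "forest_mat n E w \<in> carrier_mat n n"
    and "(1\<^sub>m n + laplacian n E w) * forest_mat n E w = 1\<^sub>m n"
    and "forest_mat n E w * (1\<^sub>m n + laplacian n E w) = 1\<^sub>m n"
proof -
  let ?M = "1\<^sub>m n + laplacian n E w"
  have M: "?M \<in> carrier_mat n n"
    unfolding laplacian_def degree_mat_def adjacency_mat_def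
    by (intro add_carrier_mat minus_carrier_mat mat_carrier)
  have "?M \<in> Units (ring_mat TYPE(real) n ())"
    using det_non_zero_imp_unit[OF M det_forest_nonzero[OF assms]] .
  with mat_inverse(1)[OF M, where b = "()"] have "mat_inverse ?M \<noteq> None" by blast
  then obtain B where B: "mat_inverse ?M = Some B" by blast
  show "forest_mat n E w \<in> carrier_mat n n" "?M * forest_mat n E w = 1\<^sub>m n"
    "forest_mat n E w * ?M = 1\<^sub>m n"
    using mat_inverse(2)[OF M B] by (simp_all add: forest_mat_def B)
qed

end

(* The path on three nodes with unit weights is a counterexample: its forest index is 9/4, deleting
   either edge raises it to 4, and deleting both raises it to 6. So the second deletion gains 2,
   more than the 7/4 gained by the first. *)
theory Submission
  imports Defs
begin

text \<open>A left inverse and a right inverse of the same matrix agree, by associativity. So a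
  single product check identifies a guessed forest matrix, and \<open>mat_inverse\<close> never has
  to be executed.\<close>

lemma forest_mat_eqI:
  assumes g: "weighted_graph n E w" and B: "B \<in> carrier_mat n n"
    and inv: "(1\<^sub>m n + laplacian n E w) * B = 1\<^sub>m n"
  shows "forest_mat n E w = B"
proof -
  let ?M = "1\<^sub>m n + laplacian n E w" and ?F = "forest_mat n E w"
  have M: "?M \<in> carrier_mat n n"
    unfolding laplacian_def degree_mat_def adjacency_mat_def
    by (intro add_carrier_mat minus_carrier_mat mat_carrier)
  note F = forest_mat_inverse[OF g]
  have "?F = ?F * (?M * B)" using F(1) inv by simp
  also have "\<dots> = (?F * ?M) * B" by (rule assoc_mult_mat[symmetric, OF F(1) M B])
  also have "\<dots> = B" using F(3) B by simp
  finally show ?thesis .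
qed

text \<open>\<open>degree_eq_sum_adjacency\<close> replaces the sum over incident edges by a sum
  over nodes, which unfolds to plain numbers once \<open>n\<close> is concrete.\<close>

lemma laplacian_eq:
  assumes "weighted_graph n E w"
  shows "laplacian n E w = mat n n (\<lambda>(i, j).
    (if i = j then \<Sum>k<n. if {i, k} \<in> E then w {i, k} else 0 else 0) -
    (if {i, j} \<in> E then w {i, j} else 0))"
  by (rule eq_matI)
    (auto simp: laplacian_def degree_mat_def adjacency_mat_def degree_eq_sum_adjacency[OF assms]
      intro!: sum.cong)

text \<open>Certificate form: \<open>b\<close> is a proposed inverse, and the second hypothesis is
  \<open>(I + L) b = I\<close> read entrywise, with the identity absorbed into the diagonal as
  \<open>1 +\<close> degree. For concrete \<open>n\<close> this is finite arithmetic.\<close>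

lemma forest_index_eqI:
  assumes "weighted_graph n E w"
    and "\<And>i j. i < n \<Longrightarrow> j < n \<Longrightarrow>
      (\<Sum>k<n. ((if i = k then 1 + (\<Sum>l<n. if {i, l} \<in> E then w {i, l} else 0) else 0) -
        (if {i, k} \<in> E then w {i, k} else 0)) * b k j) = (if i = j then 1 else 0)"
  shows "forest_index n E w = (\<Sum>j<n. \<Sum>i<j. b i i + b j j - 2 * b i j)"
proof -
  have "forest_mat n E w = mat n n (\<lambda>(i, j). b i j)"
  proof (rule forest_mat_eqI[OF assms(1)])
    show "(1\<^sub>m n + laplacian n E w) * mat n n (\<lambda>(i, j). b i j) = 1\<^sub>m n"
    proof (rule eq_matI)
      fix i j assume "i < dim_row (1\<^sub>m n :: real mat)" "j < dim_col (1\<^sub>m n :: real mat)"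
      then have ij: "i < n" "j < n" by auto
      then have "((1\<^sub>m n + laplacian n E w) * mat n n (\<lambda>(i, j). b i j)) $$ (i, j) =
        (\<Sum>k<n. ((if i = k then 1 + (\<Sum>l<n. if {i, l} \<in> E then w {i, l} else 0) else 0) -
          (if {i, k} \<in> E then w {i, k} else 0)) * b k j)"
        by (auto simp: laplacian_eq[OF assms(1)] scalar_prod_def lessThan_atLeast0
            intro!: sum.cong)
      then show "((1\<^sub>m n + laplacian n E w) * mat n n (\<lambda>(i, j). b i j)) $$ (i, j) =
          1\<^sub>m n $$ (i, j)"
        using assms(2) ij by simp
    qed (simp_all add: laplacian_eq[OF assms(1)])
  qed simp
  then show ?thesis
    unfolding forest_index_def Let_def by (auto intro!: sum.cong)
qed

text \<open>Covers at once the path and every graph left after deleting some of its edges.\<close>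

lemma weighted_graph_subpath:
  assumes "E \<subseteq> {{0, 1}, {1, 2}}"
  shows "weighted_graph 3 E (\<lambda>_. 1)"
proof -
  have "\<exists>i<3. \<exists>j<3. i \<noteq> j \<and> e = {i, j}" if e: "e \<in> E" for e
  proof -
    consider "e = {0, 1}" | "e = {1, 2}" using e assms by blast
    then show ?thesis
    proof cases
      case 1
      then show ?thesis by (intro exI[of _ 0] exI[of _ 1] conjI) simp_all
    next
      case 2
      then show ?thesis by (intro exI[of _ 1] exI[of _ 2] conjI) simp_all
    qed
  qed
  then show ?thesis by (simp add: weighted_graph_def)
qed

lemma sum_lessThan_3: "(\<Sum>k<3. f k) = f 0 + f 1 + f 2" for f :: "nat \<Rightarrow> 'a :: comm_monoid_add"
  by (simp add: eval_nat_numeral ac_simps)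

lemma sum_pairs_lessThan_3: "(\<Sum>j<3. \<Sum>i<j. f i j) = f 0 1 + f 0 2 + f 1 2"
  for f :: "nat \<Rightarrow> nat \<Rightarrow> 'a :: comm_monoid_add"
  by (simp add: eval_nat_numeral ac_simps)

lemma lessThan_3_cases:
  assumes "i < (3 :: nat)"
  obtains "i = 0" | "i = 1" | "i = 2"
  using assms by linarith

lemma forest_index_no_edges: "forest_index 3 {} (\<lambda>_. 1) = 6"
proof -
  \<comment> \<open>Without edges the Laplacian vanishes, so the forest matrix is the identity and
    each of the three pairs contributes 2.\<close>
  let ?b = "\<lambda>i j. [[1, 0, 0], [0, 1, 0], [0, 0, 1]] ! i ! j :: real"
  have "forest_index 3 {} (\<lambda>_. 1) = (\<Sum>j<3. \<Sum>i<j. ?b i i + ?b j j - 2 * ?b i j)"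
  proof (rule forest_index_eqI)
    show "weighted_graph 3 {} (\<lambda>_. 1)" by (rule weighted_graph_subpath) simp
  qed (elim lessThan_3_cases; simp add: sum_lessThan_3 doubleton_eq_iff)
  also have "\<dots> = 6" by (simp add: sum_pairs_lessThan_3)
  finally show ?thesis .
qed

lemma forest_index_edge_01: "forest_index 3 {{0, 1}} (\<lambda>_. 1) = 4"
proof -
  \<comment> \<open>The edge gives the block \<open>[[2, -1], [-1, 2]]\<close> of determinant 3,
    inverted here; the isolated node 2 keeps the entry 1.\<close>
  let ?b = "\<lambda>i j. [[2/3, 1/3, 0], [1/3, 2/3, 0], [0, 0, 1]] ! i ! j :: real"
  have "forest_index 3 {{0, 1}} (\<lambda>_. 1) = (\<Sum>j<3. \<Sum>i<j. ?b i i + ?b j j - 2 * ?b i j)"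
  proof (rule forest_index_eqI)
    show "weighted_graph 3 {{0, 1}} (\<lambda>_. 1)" by (rule weighted_graph_subpath) simp
  \<comment> \<open>Nine entry checks; \<open>doubleton_eq_iff\<close> decides which node pairs are
    edges.\<close>
  qed (elim lessThan_3_cases; simp add: sum_lessThan_3 doubleton_eq_iff)
  also have "\<dots> = 4" by (simp add: sum_pairs_lessThan_3)
  finally show ?thesis .
qed

lemma forest_index_edge_12: "forest_index 3 {{1, 2}} (\<lambda>_. 1) = 4"
proof -
  \<comment> \<open>Mirror image of the previous case under swapping nodes 0 and 2.\<close>
  let ?b = "\<lambda>i j. [[1, 0, 0], [0, 2/3, 1/3], [0, 1/3, 2/3]] ! i ! j :: real"
  have "forest_index 3 {{1, 2}} (\<lambda>_. 1) = (\<Sum>j<3. \<Sum>i<j. ?b i i + ?b j j - 2 * ?b i j)"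
  proof (rule forest_index_eqI)
    show "weighted_graph 3 {{1, 2}} (\<lambda>_. 1)" by (rule weighted_graph_subpath) simp
  qed (elim lessThan_3_cases; simp add: sum_lessThan_3 doubleton_eq_iff)
  also have "\<dots> = 4" by (simp add: sum_pairs_lessThan_3)
  finally show ?thesis .
qed

lemma forest_index_path: "forest_index 3 {{0, 1}, {1, 2}} (\<lambda>_. 1) = 9 / 4"
proof -
  \<comment> \<open>Inverse of \<open>[[2, -1, 0], [-1, 3, -1], [0, -1, 2]]\<close>, whose
    determinant is 8. The pairs contribute 5/8, 1 and 5/8.\<close>
  let ?b = "\<lambda>i j. [[5/8, 1/4, 1/8], [1/4, 1/2, 1/4], [1/8, 1/4, 5/8]] ! i ! j :: real"
  have "forest_index 3 {{0, 1}, {1, 2}} (\<lambda>_. 1) = (\<Sum>j<3. \<Sum>i<j. ?b i i + ?b j j - 2 * ?b i j)"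
  proof (rule forest_index_eqI)
    show "weighted_graph 3 {{0, 1}, {1, 2}} (\<lambda>_. 1)" by (rule weighted_graph_subpath) simp
  qed (elim lessThan_3_cases; simp add: sum_lessThan_3 doubleton_eq_iff)
  also have "\<dots> = 9 / 4" by (simp add: sum_pairs_lessThan_3)
  finally show ?thesis .
qed

theorem proposition2:
  shows "\<exists>n E w. weighted_graph n E w \<and> \<not> submodular_on E (deletion_gain n E w)"
proof -
  let ?E = "{{0, 1}, {1, 2}} :: nat set set" and ?w = "\<lambda>_ :: nat set. 1 :: real"
  let ?C = "deletion_gain 3 ?E ?w"
  have graph: "weighted_graph 3 ?E ?w"
    by (rule weighted_graph_subpath) simp
  have diffs: "?E - {{1, 2}} = {{0, 1}}" "?E - {{0, 1}} = {{1, 2}}"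
    "?E - ({{0, 1}} \<union> {{1, 2}}) = {}"
    by (simp_all add: doubleton_eq_iff insert_Diff_if)
  have "\<not> submodular_on ?E ?C"
  proof
    assume sub: "submodular_on ?E ?C"
    \<comment> \<open>Submodularity is tested at \<open>S = {}\<close>, \<open>T = {{0, 1}}\<close>
      and \<open>u = {1, 2}\<close>.\<close>
    have "{} \<subseteq> {{0, 1}} \<and> {{0, 1}} \<subseteq> ?E \<and> {1, 2} \<in> ?E - {{0, 1}}"
      by (simp add: doubleton_eq_iff)
    then have "?C ({} \<union> {{1, 2}}) - ?C {} \<ge> ?C ({{0, 1}} \<union> {{1, 2}}) - ?C {{0, 1}}"
      by (rule sub[unfolded submodular_on_def, rule_format])
    \<comment> \<open>After evaluation the inequality claims
      \<open>4 - 9/4 \<ge> 6 - 4\<close>.\<close>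
    then show False
      unfolding deletion_gain_def Un_empty_left Diff_empty diffs forest_index_no_edges
        forest_index_edge_01 forest_index_edge_12 forest_index_path
      by simp
  qed
  with graph show ?thesis by (intro exI conjI)
qed

end
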